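(* Let $k>1$ be a fixed integer. There is a constant $C$, not depending on $n$, such that asymptotically almost surely (as $n\to\infty$) the diameter of an $(n+k)$-vertex random unordered increasing $k$-tree is at most $2e\log n+C$, and asymptotically almost surely the diameter of an $(n+k)$-vertex random $k$-Apollonian network is at most $\dfrac{2ek\log n}{k-1}+C$.
   Context: $\log$ is the natural logarithm and $e$ its base. The diameter of a graph is the maximum distance between two of its vertices. "Asymptotically almost surely" means with probability tending to $1$ as $n\to\infty$. An $(n+k)$-vertex random unordered increasing $k$-tree is built from a $k$-clique (complete graph on $k$ vertices) by applying the following operation $n$ times: in every time-step, a $k$-clique of the existing graph is chosen uniformly at random, a new vertex is born and is joined to all vertices of the chosen $k$-clique. An $(n+k)$-vertex random $k$-Apollonian network is built in the same way, the only difference being that once a $k$-clique is chosen in some time-step, it will never be chosen in the future (so in every time-step the $k$-clique is chosen uniformly at random from the $k$-cliques of the existing graph that have not been chosen before). *)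

theory Defs
  imports
    "HOL-Probability.Probability"
    "Graph_Theory.Pair_Digraph"
    "Graph_Theory.Shortest_Path"
begin

text \<open>
  Finite simple graphs are represented, as in the session \<open>Graph_Theory\<close>, by symmetric loop-free
  digraphs: an undirected edge between \<open>u\<close> and \<open>v\<close> is the pair of arcs \<open>(u, v)\<close>, \<open>(v, u)\<close>.
\<close>

definition cliques :: "nat \<Rightarrow> 'a pair_pre_digraph \<Rightarrow> 'a set set" where
  "cliques k G = {K. K \<subseteq> pverts G \<and> finite K \<and> card K = k \<and>
                     (\<forall>u\<in>K. \<forall>v\<in>K. u \<noteq> v \<longrightarrow> (u, v) \<in> parcs G)}"

text \<open>
  \<open>wf_digraph.\<mu>\<close> is the infimum of the total weights of the walks from \<open>u\<close> to \<open>v\<close>; with unit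
  weights this is the number of edges of a shortest path. It is \<open>\<infinity>\<close> if there is no walk, so that
  a disconnected graph has diameter \<open>\<infinity>\<close>.
\<close>

definition graph_distance :: "'a pair_pre_digraph \<Rightarrow> 'a \<Rightarrow> 'a \<Rightarrow> ereal" where
  "graph_distance G u v = wf_digraph.\<mu> (with_proj G) (\<lambda>_. 1) u v"

definition graph_diameter :: "'a pair_pre_digraph \<Rightarrow> ereal" where
  "graph_diameter G = (SUP u\<in>pverts G. SUP v\<in>pverts G. graph_distance G u v)"

definition complete_graph :: "'a set \<Rightarrow> 'a pair_pre_digraph" where
  "complete_graph V = \<lparr> pverts = V, parcs = {(u, v). u \<in> V \<and> v \<in> V \<and> u \<noteq> v} \<rparr>"

definition join_vertex :: "'a \<Rightarrow> 'a set \<Rightarrow> 'a pair_pre_digraph \<Rightarrow> 'a pair_pre_digraph" where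
  "join_vertex x K G =
     \<lparr> pverts = insert x (pverts G), parcs = parcs G \<union> {x} \<times> K \<union> K \<times> {x} \<rparr>"

text \<open>
  The vertices are numbered in order of birth: the initial clique is \<open>{..<k}\<close>, and the vertex
  born in step \<open>n + 1\<close> is \<open>n + k\<close>.
\<close>

primrec random_increasing_k_tree :: "nat \<Rightarrow> nat \<Rightarrow> nat pair_pre_digraph pmf" where
  "random_increasing_k_tree k 0 = return_pmf (complete_graph {..<k})"
| "random_increasing_k_tree k (Suc n) = do {
     G \<leftarrow> random_increasing_k_tree k n;
     K \<leftarrow> pmf_of_set (cliques k G);
     return_pmf (join_vertex (n + k) K G)
   }"

text \<open>The second component of the state is the set of the cliques chosen so far.\<close>

primrec apollonian_process :: "nat \<Rightarrow> nat \<Rightarrow> (nat pair_pre_digraph \<times> nat set set) pmf" where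
  "apollonian_process k 0 = return_pmf (complete_graph {..<k}, {})"
| "apollonian_process k (Suc n) = do {
     (G, chosen) \<leftarrow> apollonian_process k n;
     K \<leftarrow> pmf_of_set (cliques k G - chosen);
     return_pmf (join_vertex (n + k) K G, insert K chosen)
   }"

definition random_apollonian_network :: "nat \<Rightarrow> nat \<Rightarrow> nat pair_pre_digraph pmf" where
  "random_apollonian_network k n = map_pmf fst (apollonian_process k n)"

text \<open>
  \<open>pmf_of_set\<close> is only specified for finite nonempty sets; the following lemmas show that it is
  applied only to such sets (for \<open>k \<ge> 1\<close>).
\<close>

lemma finite_cliques: "finite (pverts G) \<Longrightarrow> finite (cliques k G)"
  by (rule finite_subset[of _ "Pow (pverts G)"]) (auto simp: cliques_def)

lemma complete_graph_clique: "{..<k} \<in> cliques k (complete_graph {..<k})"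
  by (simp add: cliques_def complete_graph_def)

lemma join_vertex_clique:
  assumes K: "K \<in> cliques k G" and x: "x \<notin> pverts G" and k: "k \<ge> 1"
  shows "\<exists>L. x \<in> L \<and> L \<in> cliques k (join_vertex x K G)"
proof -
  have xK: "x \<notin> K" "finite K" "card K = k" and sub: "K \<subseteq> pverts G"
    and adj: "\<And>u v. u \<in> K \<Longrightarrow> v \<in> K \<Longrightarrow> u \<noteq> v \<Longrightarrow> (u, v) \<in> parcs G"
    using K x unfolding cliques_def by blast+
  have "K \<noteq> {}" using xK k by force
  then obtain y where y: "y \<in> K" by blast
  let ?L = "insert x (K - {y})"
  have "card ?L = Suc (card (K - {y}))" using xK by (intro card_insert_disjoint) simp_all
  also have "\<dots> = k" using y xK card_Suc_Diff1[of K y] by simp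
  finally have "card ?L = k" .
  moreover have "?L \<subseteq> pverts (join_vertex x K G)"
    using sub by (auto simp: join_vertex_def)
  moreover have "(u, v) \<in> parcs (join_vertex x K G)"
    if "u \<in> ?L" "v \<in> ?L" "u \<noteq> v" for u v
    using that adj by (auto simp: join_vertex_def)
  moreover have "finite ?L" using xK by simp
  ultimately have "?L \<in> cliques k (join_vertex x K G)"
    unfolding cliques_def by blast
  then show ?thesis by blast
qed

lemma random_increasing_k_tree_support:
  assumes k: "k \<ge> 1"
  shows "G \<in> set_pmf (random_increasing_k_tree k n) \<Longrightarrow>
           pverts G = {..<n + k} \<and> finite (cliques k G) \<and> cliques k G \<noteq> {}"
proof (induction n arbitrary: G)
  case 0
  then have G: "G = complete_graph {..<k}" by simp
  have V: "pverts G = {..<0 + k}" by (simp add: G complete_graph_def)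
  moreover have "finite (cliques k G)" using V by (intro finite_cliques) simp
  ultimately show ?case using complete_graph_clique[of k] unfolding G by blast
next
  case (Suc n)
  from Suc.prems obtain H K where H: "H \<in> set_pmf (random_increasing_k_tree k n)"
    and K: "K \<in> set_pmf (pmf_of_set (cliques k H))" and G: "G = join_vertex (n + k) K H"
    by (auto simp: set_bind_pmf)
  from Suc.IH[OF H] have HV: "pverts H = {..<n + k}"
    and fin: "finite (cliques k H)" and ne: "cliques k H \<noteq> {}" by blast+
  have K': "K \<in> cliques k H" using K set_pmf_of_set[OF ne fin] by blast
  have "n + k \<notin> pverts H" by (simp add: HV)
  from join_vertex_clique[OF K' this k] have "cliques k G \<noteq> {}" unfolding G by blast
  moreover have V: "pverts G = {..<Suc n + k}"
    by (simp add: G join_vertex_def HV lessThan_Suc)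
  moreover have "finite (cliques k G)" using V by (intro finite_cliques) simp
  ultimately show ?case by blast
qed

lemma apollonian_process_support:
  assumes k: "k \<ge> 1"
  shows "(G, A) \<in> set_pmf (apollonian_process k n) \<Longrightarrow>
           pverts G = {..<n + k} \<and> (\<forall>K\<in>A. K \<subseteq> {..<n + k}) \<and>
           finite (cliques k G - A) \<and> cliques k G - A \<noteq> {}"
proof (induction n arbitrary: G A)
  case 0
  then have G: "G = complete_graph {..<k}" and A: "A = {}" by auto
  have V: "pverts G = {..<0 + k}" by (simp add: G complete_graph_def)
  moreover have "finite (cliques k G)" using V by (intro finite_cliques) simp
  ultimately show ?case using complete_graph_clique[of k] unfolding G A by blast
next
  case (Suc n)
  from Suc.prems obtain H B K where H: "(H, B) \<in> set_pmf (apollonian_process k n)"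
    and K: "K \<in> set_pmf (pmf_of_set (cliques k H - B))"
    and G: "G = join_vertex (n + k) K H" and A: "A = insert K B"
    by (auto simp: set_bind_pmf)
  from Suc.IH[OF H] have HV: "pverts H = {..<n + k}" and B: "\<forall>K\<in>B. K \<subseteq> {..<n + k}"
    and fin: "finite (cliques k H - B)" and ne: "cliques k H - B \<noteq> {}" by blast+
  have K': "K \<in> cliques k H" using K set_pmf_of_set[OF ne fin] by blast
  have KV: "K \<subseteq> {..<n + k}" using K' HV unfolding cliques_def by blast
  have "n + k \<notin> pverts H" by (simp add: HV)
  from join_vertex_clique[OF K' this k] obtain L
    where L: "n + k \<in> L" "L \<in> cliques k G" unfolding G by blast
  have AV: "\<forall>M\<in>A. M \<subseteq> {..<n + k}" using B KV unfolding A by blast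
  then have "L \<notin> A" using L(1) by blast
  moreover have "\<forall>M\<in>A. M \<subseteq> {..<Suc n + k}" using AV by fastforce
  moreover have V: "pverts G = {..<Suc n + k}"
    by (simp add: G join_vertex_def HV lessThan_Suc)
  moreover have "finite (cliques k G - A)"
    using V by (intro finite_Diff finite_cliques) simp
  ultimately show ?case using L(2) by blast
qed

end

theory Submission
  imports Defs "HOL-Real_Asymp.Real_Asymp"
begin

text \<open>
  Give the initial clique depth \<open>0\<close>, and let every clique born from a chosen clique of depth \<open>d\<close>
  have depth \<open>d + 1\<close>. All vertices of a clique of depth \<open>d\<close> are within distance \<open>d\<close> of the
  initial clique, so the diameter is at most \<open>2h + 1\<close> unless a clique of depth \<open>h + 1\<close> exists.
  In step \<open>t + 1\<close> there are \<open>1 + r t\<close> cliques to choose from, with \<open>r = k\<close> for \<open>k\<close>-trees and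
  \<open>r = k - 1\<close> for Apollonian networks, and each choice creates \<open>k\<close> cliques. Hence the expected
  number of cliques of depth exactly \<open>m\<close> is at most \<open>S ^ m / m!\<close> with
  \<open>S = (\<Sum>t<n. k / (1 + r t)) \<le> (k / r) ln n + O(1)\<close>. Taking \<open>m\<close> to be \<open>e S\<close> up to a constant,
  a Stirling-type bound makes this tend to \<open>0\<close>. Counting depth exactly \<open>m\<close>, instead of bounding an
  exponential moment of the depth, gains the decaying factor that permits an additive constant \<open>C\<close>.
\<close>

section \<open>Walks and distances\<close>

text \<open>Relational powers of the arc set replace walks from here on: they are easy to
  concatenate, to reverse, and to transfer to a larger graph. Only the upper bound on distance is
  needed, so exhibiting one walk with \<open>m\<close> arcs suffices.\<close>

lemma graph_distance_le_relpow:
  assumes arcs: "parcs G \<subseteq> pverts G \<times> pverts G" and u: "u \<in> pverts G"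
    and uv: "(u, v) \<in> parcs G ^^ m"
  shows "graph_distance G u v \<le> ereal (real m)"
proof -
  interpret pair_wf_digraph G
    using arcs by unfold_locales auto
  have "\<exists>p. pre_digraph.awalk (with_proj G) u p v \<and> length p = m"
    using u uv
  proof (induction m arbitrary: u)
    case 0
    then show ?case by (auto simp: awalk_Nil_iff)
  next
    case (Suc m)
    then obtain w where w: "(u, w) \<in> parcs G" "(w, v) \<in> parcs G ^^ m"
      by (meson relpow_Suc_E2)
    moreover have "w \<in> pverts G" using w(1) arcs by blast
    ultimately obtain p where "pre_digraph.awalk (with_proj G) w p v" "length p = m"
      using Suc.IH by blast
    then have "pre_digraph.awalk (with_proj G) u ((u, w) # p) v" "length ((u, w) # p) = Suc m"
      using w(1) by (auto simp: awalk_Cons_iff)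
    then show ?case by blast
  qed
  then obtain p where p: "pre_digraph.awalk (with_proj G) u p v" "length p = m"
    by blast
  have "awalk_cost (\<lambda>_. 1) p = real m"
    using p(2) by (simp add: awalk_cost_def sum_list_triv)
  then show ?thesis
    using min_cost_le_walk_cost[OF p(1), of "\<lambda>_. 1"] by (simp add: graph_distance_def)
qed

lemma relpow_sym: "sym R \<Longrightarrow> (u, v) \<in> R ^^ m \<Longrightarrow> (v, u) \<in> R ^^ m"
proof (induction m arbitrary: v)
  case (Suc m)
  then obtain w where "(u, w) \<in> R ^^ m" "(w, v) \<in> R" by (meson relpow_Suc_E)
  then show ?case using Suc by (meson relpow_Suc_I2 symD)
qed simp

section \<open>Cliques created by a new vertex\<close>

lemma cliques_complete_graph: "cliques k (complete_graph {..<k}) = {{..<k}}"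
  using complete_graph_clique[of k]
  by (auto simp: cliques_def complete_graph_def card_subset_eq dest: card_subset_eq[rotated])

text \<open>The neighbours of the new vertex \<open>x\<close> are exactly the elements of
  \<open>K\<close>. A clique through \<open>x\<close> therefore consists of \<open>x\<close> and
  \<open>k - 1\<close> elements of \<open>K\<close>, that is, it omits exactly one of them.\<close>

lemma cliques_join_vertex:
  assumes K: "K \<in> cliques k G" and x: "x \<notin> pverts G"
    and arcs: "parcs G \<subseteq> pverts G \<times> pverts G" and k: "k \<ge> 1"
  shows "cliques k (join_vertex x K G) = cliques k G \<union> (\<lambda>y. insert x (K - {y})) ` K"
proof (intro equalityI subsetI)
  have Kf: "finite K" "card K = k" "K \<subseteq> pverts G"
    and adj: "\<And>u v. u \<in> K \<Longrightarrow> v \<in> K \<Longrightarrow> u \<noteq> v \<Longrightarrow> (u, v) \<in> parcs G"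
    using K unfolding cliques_def by blast+
  then have xK: "x \<notin> K" using x by blast
  {
    fix L assume L: "L \<in> cliques k (join_vertex x K G)"
    then have Lf: "finite L" "card L = k" "L \<subseteq> insert x (pverts G)"
      and Ladj: "\<And>u v. u \<in> L \<Longrightarrow> v \<in> L \<Longrightarrow> u \<noteq> v \<Longrightarrow>
        (u, v) \<in> parcs G \<or> (u = x \<and> v \<in> K) \<or> (u \<in> K \<and> v = x)"
      unfolding cliques_def join_vertex_def by auto
    show "L \<in> cliques k G \<union> (\<lambda>y. insert x (K - {y})) ` K"
    proof (cases "x \<in> L")
      case False
      then have "L \<in> cliques k G"
        using Lf Ladj unfolding cliques_def by blast
      then show ?thesis by blast
    next
      case True
      have sub: "L - {x} \<subseteq> K"
      proof
        fix v assume v: "v \<in> L - {x}"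
        then have "(x, v) \<in> parcs G \<or> v \<in> K" using Ladj[of x v] True by auto
        then show "v \<in> K" using arcs x by blast
      qed
      have "card (L - {x}) = k - 1" using True Lf by simp
      then have "card (K - (L - {x})) = 1"
        using sub Kf k Lf by (simp add: card_Diff_subset)
      then obtain y where y: "K - (L - {x}) = {y}" by (auto simp: card_1_singleton_iff)
      then have "y \<in> K" "L = insert x (K - {y})" using sub True by blast+
      then show ?thesis by blast
    qed
  next
    fix L assume "L \<in> cliques k G \<union> (\<lambda>y. insert x (K - {y})) ` K"
    then show "L \<in> cliques k (join_vertex x K G)"
    proof
      assume "L \<in> cliques k G"
      then show ?thesis unfolding cliques_def join_vertex_def by auto
    next
      assume "L \<in> (\<lambda>y. insert x (K - {y})) ` K"
      then obtain y where y: "y \<in> K" "L = insert x (K - {y})" by blast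
      have "finite L" "card L = k"
        using y Kf xK k by auto
      moreover have "L \<subseteq> pverts (join_vertex x K G)"
        using y Kf by (auto simp: join_vertex_def)
      moreover have "(u, v) \<in> parcs (join_vertex x K G)" if "u \<in> L" "v \<in> L" "u \<noteq> v" for u v
        using that y adj by (auto simp: join_vertex_def)
      ultimately show ?thesis unfolding cliques_def by blast
    qed
  }
qed

section \<open>Depth-labelled processes and their projections\<close>

text \<open>
  Both processes at once, with each clique carrying a depth: the flag \<open>b\<close> tells whether chosen
  cliques are retired.
\<close>

primrec depth_process ::
    "bool \<Rightarrow> nat \<Rightarrow> nat \<Rightarrow> (nat pair_pre_digraph \<times> nat set set \<times> (nat set \<Rightarrow> nat)) pmf" where
  "depth_process b k 0 = return_pmf (complete_graph {..<k}, {}, \<lambda>_. 0)"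
| "depth_process b k (Suc n) = do {
     (G, B, D) \<leftarrow> depth_process b k n;
     K \<leftarrow> pmf_of_set (cliques k G - B);
     return_pmf (join_vertex (n + k) K G, if b then insert K B else B,
                 \<lambda>L. if n + k \<in> L then Suc (D K) else D L)
   }"

lemma map_depth_process_True:
  "map_pmf (\<lambda>(G, B, D). (G, B)) (depth_process True k n) = apollonian_process k n"
proof (induction n)
  case (Suc n)
  show ?case
    by (simp add: map_bind_pmf Suc.IH[symmetric] bind_map_pmf case_prod_unfold)
qed simp

text \<open>The pair is kept, rather than the graph alone, so that the induction hypothesis also
  records that the retired set stays empty; then \<open>cliques k G - B\<close> is
  \<open>cliques k G\<close>.\<close>

lemma map_depth_process_False:
  "map_pmf (\<lambda>(G, B, D). (G, B)) (depth_process False k n) =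
     map_pmf (\<lambda>G. (G, {})) (random_increasing_k_tree k n)"
proof (induction n)
  case (Suc n)
  have "map_pmf (\<lambda>(G, B, D). (G, B)) (depth_process False k (Suc n)) =
     bind_pmf (map_pmf (\<lambda>(G, B, D). (G, B)) (depth_process False k n))
       (\<lambda>(G, B). bind_pmf (pmf_of_set (cliques k G - B)) (\<lambda>K. return_pmf (join_vertex (n + k) K G, B)))"
    by (simp add: map_bind_pmf bind_map_pmf case_prod_unfold)
  then show ?case
    unfolding Suc.IH by (simp add: map_bind_pmf bind_map_pmf)
qed simp

lemma map_fst_depth_process_True:
  "map_pmf fst (depth_process True k n) = random_apollonian_network k n"
  unfolding random_apollonian_network_def map_depth_process_True[symmetric]
  by (simp add: pmf.map_comp comp_def case_prod_unfold)

lemma map_fst_depth_process_False: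
  "map_pmf fst (depth_process False k n) = random_increasing_k_tree k n"
proof -
  have "map_pmf fst (depth_process False k n) =
      map_pmf fst (map_pmf (\<lambda>(G, B, D). (G, B)) (depth_process False k n))"
    by (simp add: pmf.map_comp comp_def case_prod_unfold)
  then show ?thesis by (simp add: map_depth_process_False pmf.map_comp comp_def)
qed

section \<open>Invariants of the depth process and the diameter bound\<close>

text \<open>The condition on \<open>{..D K}\<close> says that depths have no gaps: a clique deeper
  than \<open>h\<close> forces one of depth exactly \<open>h + 1\<close>. The last condition bounds
  the distance from each vertex of a clique to the initial clique by the depth.\<close>

definition depth_state ::
    "bool \<Rightarrow> nat \<Rightarrow> nat \<Rightarrow> nat pair_pre_digraph \<Rightarrow> nat set set \<Rightarrow> (nat set \<Rightarrow> nat) \<Rightarrow> bool" where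
  "depth_state b k n G B D \<longleftrightarrow>
     pverts G = {..<n + k} \<and> parcs G \<subseteq> pverts G \<times> pverts G \<and> sym (parcs G) \<and>
     {..<k} \<in> cliques k G \<and> \<Union> (cliques k G) = pverts G \<and>
     card (cliques k G) = 1 + k * n \<and> B \<subseteq> cliques k G \<and> card B = (if b then n else 0) \<and>
     (\<forall>K\<in>cliques k G. {..D K} \<subseteq> D ` cliques k G \<and>
        (\<forall>v\<in>K. \<exists>u<k. \<exists>m\<le>D K. (u, v) \<in> parcs G ^^ m))"

text \<open>With retirement each step removes one clique, leaving \<open>1 + k * n - n\<close>;
  since \<open>k >= 1\<close>, natural subtraction causes no truncation. The leading 1 gives
  nonemptiness.\<close>

lemma card_available_cliques:
  assumes "depth_state b k n G B D" and "k \<ge> 1"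
  shows "finite (cliques k G)" and "card (cliques k G - B) = 1 + (k - of_bool b) * n"
    and "cliques k G - B \<noteq> {}"
proof -
  show fin: "finite (cliques k G)"
    using assms by (intro finite_cliques) (simp add: depth_state_def)
  have B: "B \<subseteq> cliques k G" using assms by (simp add: depth_state_def)
  have "card (cliques k G - B) = card (cliques k G) - card B"
    using finite_subset[OF B fin] B by (rule card_Diff_subset)
  then have "card (cliques k G - B) = 1 + k * n - (if b then n else 0)"
    using assms by (simp add: depth_state_def)
  then show *: "card (cliques k G - B) = 1 + (k - of_bool b) * n"
    using assms(2) by (cases k) auto
  show "cliques k G - B \<noteq> {}" using * by (metis card.empty add_is_0 one_neq_zero)
qed

text \<open>Old cliques miss \<open>x\<close>, and the dropped vertex \<open>y\<close> can be
  recovered from a new clique, so the new cliques are distinct from each other and from the old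
  ones.\<close>

lemma join_vertex_new_cliques:
  assumes K: "K \<in> cliques k G" and x: "x \<notin> pverts G"
  shows "inj_on (\<lambda>y. insert x (K - {y})) K"
    and "cliques k G \<inter> (\<lambda>y. insert x (K - {y})) ` K = {}"
    and "L \<in> cliques k G \<Longrightarrow> x \<notin> L"
proof -
  have xL: "x \<notin> L" if "L \<in> cliques k G" for L
    using that x unfolding cliques_def by blast
  then show "L \<in> cliques k G \<Longrightarrow> x \<notin> L" .
  show "inj_on (\<lambda>y. insert x (K - {y})) K"
  proof (rule inj_onI)
    fix y z assume yz: "y \<in> K" "z \<in> K" and eq: "insert x (K - {y}) = insert x (K - {z})"
    have "y \<notin> insert x (K - {z})" using xL[OF K] yz(1) unfolding eq[symmetric] by auto
    then show "y = z" using yz(1) by blast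
  qed
  show "cliques k G \<inter> (\<lambda>y. insert x (K - {y})) ` K = {}"
    using xL by blast
qed

text \<open>Old cliques avoid \<open>x\<close> and keep their depth, while all \<open>k\<close> new
  ones receive depth \<open>Suc (D K)\<close>. Only that one level changes.\<close>

lemma card_cliques_join_vertex_depth:
  assumes K: "K \<in> cliques k G" and x: "x \<notin> pverts G" and fin: "finite (cliques k G)"
    and arcs: "parcs G \<subseteq> pverts G \<times> pverts G" and k: "k \<ge> 1"
  shows "card {L \<in> cliques k (join_vertex x K G). (if x \<in> L then Suc (D K) else D L) = m} =
           card {L \<in> cliques k G. D L = m} + (if Suc (D K) = m then k else 0)"
proof -
  let ?N = "(\<lambda>y. insert x (K - {y})) ` K"
  note new = join_vertex_new_cliques[OF K x]
  have cK: "finite K" "card K = k" using K by (auto simp: cliques_def)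
  have "{L \<in> cliques k (join_vertex x K G). (if x \<in> L then Suc (D K) else D L) = m} =
      {L \<in> cliques k G. D L = m} \<union> (if Suc (D K) = m then ?N else {})"
    unfolding cliques_join_vertex[OF K x arcs k] using new(3) by auto
  also have "card \<dots> = card {L \<in> cliques k G. D L = m} + card (if Suc (D K) = m then ?N else {})"
    using fin cK new(2) by (intro card_Un_disjoint) auto
  finally show ?thesis using new(1) cK by (simp add: card_image)
qed

lemma depth_state_0: "k \<ge> 1 \<Longrightarrow> depth_state b k 0 (complete_graph {..<k}) {} (\<lambda>_. 0)"
  by (auto simp: depth_state_def cliques_complete_graph) (auto simp: complete_graph_def sym_def)

lemma depth_state_Suc:
  assumes S: "depth_state b k n G B D" and KB: "K \<in> cliques k G - B" and k: "k > 1"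
  shows "depth_state b k (Suc n) (join_vertex (n + k) K G) (if b then insert K B else B)
           (\<lambda>L. if n + k \<in> L then Suc (D K) else D L)"
proof -
  let ?x = "n + k" let ?G = "join_vertex (n + k) K G"
  let ?D = "\<lambda>L. if n + k \<in> L then Suc (D K) else D L"
  let ?N = "(\<lambda>y. insert ?x (K - {y})) ` K"
  have V: "pverts G = {..<n + k}" and arcs: "parcs G \<subseteq> pverts G \<times> pverts G"
    and sym: "sym (parcs G)" and init: "{..<k} \<in> cliques k G"
    and cover: "\<Union> (cliques k G) = pverts G" and card: "card (cliques k G) = 1 + k * n"
    and B: "B \<subseteq> cliques k G" "card B = (if b then n else 0)"
    and level: "\<And>K. K \<in> cliques k G \<Longrightarrow> {..D K} \<subseteq> D ` cliques k G"
    and dist: "\<And>K v. K \<in> cliques k G \<Longrightarrow> v \<in> K \<Longrightarrow> \<exists>u<k. \<exists>m\<le>D K. (u, v) \<in> parcs G ^^ m"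
    using S unfolding depth_state_def by blast+
  have fin: "finite (cliques k G)" using V by (intro finite_cliques) simp
  have K: "K \<in> cliques k G" "K \<notin> B" using KB by auto
  have x: "?x \<notin> pverts G" using V by simp
  have k1: "k \<ge> 1" using k by simp
  have cK: "finite K" "card K = k" "K \<subseteq> pverts G" using K by (auto simp: cliques_def)
  note new = join_vertex_new_cliques[OF K(1) x]
  note cl = cliques_join_vertex[OF K(1) x arcs k1]
  \<comment> \<open>A single \<open>y0\<close> serves twice: dropping it from \<open>K\<close>
    produces a concrete new clique, and the arc from it reaches the new vertex.\<close>
  obtain y0 where y0: "y0 \<in> K" using cK k by fastforce
  have "pverts ?G = {..<Suc n + k}" by (auto simp: join_vertex_def V)
  moreover have arcs': "parcs ?G \<subseteq> pverts ?G \<times> pverts ?G"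
    using arcs cK by (auto simp: join_vertex_def)
  moreover have "sym (parcs ?G)" using sym by (auto simp: join_vertex_def sym_def)
  moreover have "{..<k} \<in> cliques k ?G" using init cl by blast
  moreover have "\<Union> (cliques k ?G) = pverts ?G"
  proof -
    have "\<Union> ?N \<subseteq> insert ?x (pverts G)" using cK by blast
    moreover have "?x \<in> \<Union> ?N" using y0 by blast
    ultimately have "pverts G \<union> \<Union> ?N = insert ?x (pverts G)" by blast
    then show ?thesis unfolding cl Union_Un_distrib cover by (simp add: join_vertex_def)
  qed
  moreover have "card (cliques k ?G) = 1 + k * Suc n"
    unfolding cl using card_Un_disjoint[OF fin _ new(2)] cK card card_image[OF new(1)] by simp
  moreover have "(if b then insert K B else B) \<subseteq> cliques k ?G"
    using B K cl by auto
  moreover have "card (if b then insert K B else B) = (if b then Suc n else 0)"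
    using B K finite_subset[OF B(1) fin] by auto
  moreover have "{..?D L} \<subseteq> ?D ` cliques k ?G \<and>
        (\<forall>v\<in>L. \<exists>u<k. \<exists>m\<le>?D L. (u, v) \<in> parcs ?G ^^ m)" if L: "L \<in> cliques k ?G" for L
  proof
    have old: "D ` cliques k G \<subseteq> ?D ` cliques k ?G"
    proof
      fix d assume "d \<in> D ` cliques k G"
      then obtain M where "M \<in> cliques k G" "d = D M" by blast
      then have "d = ?D M" "M \<in> cliques k ?G" using new(3) cl by auto
      then show "d \<in> ?D ` cliques k ?G" by blast
    qed
    have mono: "parcs G ^^ m \<subseteq> parcs ?G ^^ m" for m
      by (induction m) (auto simp: join_vertex_def)
    \<comment> \<open>The new depth exceeds that of the chosen clique by only one, so no gap can
      open.\<close>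
    have "{..Suc (D K)} \<subseteq> ?D ` cliques k ?G"
    proof -
      have "insert ?x (K - {y0}) \<in> cliques k ?G" using cl y0 by blast
      then have "?D (insert ?x (K - {y0})) \<in> ?D ` cliques k ?G" by (rule imageI)
      then have "Suc (D K) \<in> ?D ` cliques k ?G" by simp
      then show ?thesis using level[OF K(1)] old unfolding atMost_Suc by blast
    qed
    moreover have "{..D L} \<subseteq> ?D ` cliques k ?G" if "?x \<notin> L"
    proof -
      have "L \<in> cliques k G" using L that cl by auto
      then show ?thesis using level old by blast
    qed
    ultimately show "{..?D L} \<subseteq> ?D ` cliques k ?G" by auto
    show "\<forall>v\<in>L. \<exists>u<k. \<exists>m\<le>?D L. (u, v) \<in> parcs ?G ^^ m"
    proof
      fix v assume v: "v \<in> L"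
      show "\<exists>u<k. \<exists>m\<le>?D L. (u, v) \<in> parcs ?G ^^ m"
      proof (cases "?x \<in> L")
        case False
        then have "L \<in> cliques k G" using L cl by auto
        then show ?thesis using dist[OF _ v] mono False by auto
      next
        case True
        then have LN: "L \<in> ?N" using L cl new(3) by blast
        show ?thesis
        proof (cases "v = ?x")
          case False
          then have "v \<in> K" using LN v by auto
          then obtain u m where "u < k" "m \<le> D K" "(u, v) \<in> parcs G ^^ m"
            using dist[OF K(1)] by blast
          then show ?thesis using mono True by (auto intro: le_SucI)
        next
          \<comment> \<open>The new vertex is the only one that needs an extra arc, and this is what
            the increase of the depth pays for.\<close>
          case v: True
          obtain u m where um: "u < k" "m \<le> D K" "(u, y0) \<in> parcs G ^^ m"
            using dist[OF K(1) y0] by blast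
          have "(y0, ?x) \<in> parcs ?G" using y0 by (auto simp: join_vertex_def)
          then have "(u, v) \<in> parcs ?G ^^ Suc m"
            using um(3) mono v by (auto intro: relpow_Suc_I)
          then show ?thesis using um True by (metis Suc_le_mono)
        qed
      qed
    qed
  qed
  ultimately show ?thesis unfolding depth_state_def by blast
qed

lemma depth_process_support:
  assumes k: "k > 1"
  shows "(G, B, D) \<in> set_pmf (depth_process b k n) \<Longrightarrow> depth_state b k n G B D"
proof (induction n arbitrary: G B D)
  case 0
  then show ?case using depth_state_0[of k b] k by simp
next
  case (Suc n)
  from Suc.prems obtain H A E K where H: "(H, A, E) \<in> set_pmf (depth_process b k n)"
    and K: "K \<in> set_pmf (pmf_of_set (cliques k H - A))"
    and eq: "G = join_vertex (n + k) K H" "B = (if b then insert K A else A)"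
      "D = (\<lambda>L. if n + k \<in> L then Suc (E K) else E L)"
    by (auto simp: set_bind_pmf)
  have S: "depth_state b k n H A E" using Suc.IH[OF H] .
  have "K \<in> cliques k H - A"
    using K card_available_cliques[OF S] k by (subst (asm) set_pmf_of_set) auto
  then show ?case unfolding eq using depth_state_Suc[OF S _ k] by blast
qed

text \<open>Go from \<open>u\<close> to the initial clique in at most \<open>h\<close> arcs, cross
  that clique by at most one arc, and descend to \<open>v\<close> in at most \<open>h\<close>
  arcs.\<close>

lemma depth_state_diameter:
  assumes S: "depth_state b k n G B D" and h: "\<And>K. K \<in> cliques k G \<Longrightarrow> D K \<le> h"
  shows "graph_diameter G \<le> ereal (2 * real h + 1)"
proof -
  have arcs: "parcs G \<subseteq> pverts G \<times> pverts G"
    and sym: "sym (parcs G)" and init: "{..<k} \<in> cliques k G"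
    and cover: "\<Union> (cliques k G) = pverts G"
    and dist: "\<And>K v. K \<in> cliques k G \<Longrightarrow> v \<in> K \<Longrightarrow> \<exists>u<k. \<exists>m\<le>D K. (u, v) \<in> parcs G ^^ m"
    using S unfolding depth_state_def by blast+
  have root: "\<exists>u<k. \<exists>m\<le>h. (u, v) \<in> parcs G ^^ m" if "v \<in> pverts G" for v
  proof -
    have "v \<in> \<Union> (cliques k G)" using that cover by simp
    then obtain K where "K \<in> cliques k G" "v \<in> K" by (elim UnionE)
    then show ?thesis using dist h by (meson le_trans)
  qed
  have "graph_distance G u v \<le> ereal (2 * real h + 1)" if u: "u \<in> pverts G" and v: "v \<in> pverts G" for u v
  proof -
    obtain a i where a: "a < k" "i \<le> h" "(a, u) \<in> parcs G ^^ i" using root[OF u] by blast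
    obtain c j where c: "c < k" "j \<le> h" "(c, v) \<in> parcs G ^^ j" using root[OF v] by blast
    have "\<exists>l\<le>1. (a, c) \<in> parcs G ^^ l"
    proof (cases "a = c")
      case False
      then have "(a, c) \<in> parcs G ^^ 1" using init a c by (auto simp: cliques_def)
      then show ?thesis by blast
    qed (auto intro: exI[of _ 0])
    then obtain l where l: "l \<le> 1" "(a, c) \<in> parcs G ^^ l" by blast
    have "(u, v) \<in> parcs G ^^ (i + l + j)"
      using relpow_sym[OF sym a(3)] l(2) c(3) unfolding relpow_add by blast
    then have "graph_distance G u v \<le> ereal (real (i + l + j))"
      by (rule graph_distance_le_relpow[OF arcs u])
    also have "\<dots> \<le> ereal (2 * real h + 1)" using a c l by simp
    finally show ?thesis .
  qed
  then show ?thesis unfolding graph_diameter_def by (intro SUP_least)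
qed

section \<open>Expected number of cliques at a given depth\<close>

definition weight_sum :: "nat \<Rightarrow> nat \<Rightarrow> nat \<Rightarrow> real" where
  "weight_sum k r n = (\<Sum>t<n. real k / (1 + real r * real t))"

lemma weight_sum_nonneg: "weight_sum k r n \<ge> 0"
  unfolding weight_sum_def by (intro sum_nonneg) simp

text \<open>These are the first two terms of the binomial expansion. After division by
  \<open>fact (Suc m)\<close>, the left side is what one step of the expectation recursion
  produces.\<close>

lemma power_Suc_add_ge:
  fixes x a :: real
  assumes "x \<ge> 0" "a \<ge> 0"
  shows "x ^ Suc m + real (Suc m) * a * x ^ m \<le> (x + a) ^ Suc m"
proof (induction m)
  case (Suc m)
  have "x ^ Suc (Suc m) + real (Suc (Suc m)) * a * x ^ Suc m \<le>
      (x + a) * (x ^ Suc m + real (Suc m) * a * x ^ m)"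
  proof -
    have "(x + a) * (x ^ Suc m + real (Suc m) * a * x ^ m) =
        x ^ Suc (Suc m) + real (Suc (Suc m)) * a * x ^ Suc m + real (Suc m) * (a * a) * x ^ m"
      by (simp add: algebra_simps)
    then show ?thesis using assms by simp
  qed
  also have "\<dots> \<le> (x + a) * (x + a) ^ Suc m"
    using Suc assms by (intro mult_left_mono) auto
  finally show ?case by simp
qed simp

text \<open>Write \<open>E n m\<close> for the expectation. Averaging over the chosen clique gives
  \<open>E (Suc n) m <= E n m + a * E n (m - 1)\<close> for \<open>m > 0\<close>, where
  \<open>a\<close> is the next summand of \<open>weight_sum\<close>; the induction on
  \<open>n\<close> must hence treat all \<open>m\<close> together.\<close>

lemma expected_cliques_at_depth:
  assumes k: "k > 1"
  shows "(\<integral>\<^sup>+ s. (case s of (G, B, D) \<Rightarrow> of_nat (card {L \<in> cliques k G. D L = m}))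
            \<partial>depth_process b k n)
         \<le> ennreal (weight_sum k (k - of_bool b) n ^ m / fact m)"
proof (induction n arbitrary: m)
  case 0
  \<comment> \<open>The weight sum is empty here, so the bound is \<open>0 ^ m / fact m\<close>: 1
    for \<open>m = 0\<close> and 0 otherwise, which matches the single initial clique
    exactly.\<close>
  have "card {L. L = {..<k} \<and> 0 = m} = (if m = 0 then 1 else 0)" by auto
  then show ?case by (auto simp: cliques_complete_graph weight_sum_def)
next
  case (Suc n)
  let ?r = "k - of_bool b :: nat"
  define cnt where "cnt m s = (case s of (G, B, D) \<Rightarrow>
      (of_nat (card {L \<in> cliques k G. D L = m}) :: ennreal))"
    for m and s :: "nat pair_pre_digraph \<times> nat set set \<times> (nat set \<Rightarrow> nat)"
  define S where "S = weight_sum k ?r n"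
  define a where "a = real k / (1 + real ?r * real n)"
  have a: "a \<ge> 0" "S \<ge> 0" by (auto simp: a_def S_def weight_sum_nonneg)
  have step: "(\<integral>\<^sup>+ K. cnt m (join_vertex (n + k) K G, if b then insert K B else B,
                 \<lambda>L. if n + k \<in> L then Suc (D K) else D L) \<partial>pmf_of_set (cliques k G - B))
      \<le> cnt m (G, B, D) + (case m of 0 \<Rightarrow> 0 | Suc m' \<Rightarrow> ennreal a * cnt m' (G, B, D))"
    if s: "(G, B, D) \<in> set_pmf (depth_process b k n)" for G B D
  proof -
    have st: "depth_state b k n G B D" by (rule depth_process_support[OF k s])
    have k1: "k \<ge> 1" using k by simp
    note av = card_available_cliques[OF st k1]
    have x: "n + k \<notin> pverts G" and arcs: "parcs G \<subseteq> pverts G \<times> pverts G"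
      using st by (auto simp: depth_state_def)
    have fin: "finite (cliques k G - B)" using av by simp
    have "(\<integral>\<^sup>+ K. cnt m (join_vertex (n + k) K G, if b then insert K B else B,
                 \<lambda>L. if n + k \<in> L then Suc (D K) else D L) \<partial>pmf_of_set (cliques k G - B)) =
        (\<integral>\<^sup>+ K. cnt m (G, B, D) + of_nat k * indicator {K. Suc (D K) = m} K
            \<partial>pmf_of_set (cliques k G - B))"
    proof (intro nn_integral_cong_AE AE_pmfI)
      fix K assume "K \<in> set_pmf (pmf_of_set (cliques k G - B))"
      then have "K \<in> cliques k G" using set_pmf_of_set[OF av(3) fin] by blast
      from card_cliques_join_vertex_depth[OF this x av(1) arcs k1, of D m]
      show "cnt m (join_vertex (n + k) K G, if b then insert K B else B,
                 \<lambda>L. if n + k \<in> L then Suc (D K) else D L) =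
          cnt m (G, B, D) + of_nat k * indicator {K. Suc (D K) = m} K"
        by (simp add: cnt_def)
    qed
    also have "\<dots> = cnt m (G, B, D) +
        of_nat k * emeasure (pmf_of_set (cliques k G - B)) {K. Suc (D K) = m}"
      by (simp add: nn_integral_add nn_integral_cmult)
    also have "of_nat k * emeasure (pmf_of_set (cliques k G - B)) {K. Suc (D K) = m} \<le>
        (case m of 0 \<Rightarrow> 0 | Suc m' \<Rightarrow> ennreal a * cnt m' (G, B, D))"
    proof (cases m)
      case (Suc m')
      \<comment> \<open>Only an inequality, because some cliques of depth \<open>m'\<close> may
        already be retired.\<close>
      have "card ((cliques k G - B) \<inter> {K. Suc (D K) = m}) \<le> card {L \<in> cliques k G. D L = m'}"
        using av(1) Suc by (intro card_mono) auto
      then have "real k * (real (card ((cliques k G - B) \<inter> {K. Suc (D K) = m})) /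
          real (card (cliques k G - B))) \<le> a * real (card {L \<in> cliques k G. D L = m'})"
        unfolding av(2) a_def by (simp add: divide_right_mono mult_left_mono del: of_nat_diff)
      then show ?thesis
        using Suc a by (simp add: emeasure_pmf_of_set[OF av(3) fin] cnt_def
            ennreal_of_nat_eq_real_of_nat ennreal_mult[symmetric] ennreal_leI)
    qed simp
    finally show ?thesis by (simp add: add_left_mono)
  qed
  have "(\<integral>\<^sup>+ s. cnt m s \<partial>depth_process b k (Suc n)) \<le>
      (\<integral>\<^sup>+ s. cnt m s + (case m of 0 \<Rightarrow> 0 | Suc m' \<Rightarrow> ennreal a * cnt m' s) \<partial>depth_process b k n)"
    unfolding depth_process.simps nn_integral_bind_pmf
  proof (intro nn_integral_mono_AE AE_pmfI)
    fix s assume s: "s \<in> set_pmf (depth_process b k n)"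
    obtain G B D where GBD: "s = (G, B, D)" by (cases s)
    show "(\<integral>\<^sup>+ t. cnt m t \<partial>measure_pmf (case s of (G, B, D) \<Rightarrow> pmf_of_set (cliques k G - B) \<bind>
          (\<lambda>K. return_pmf (join_vertex (n + k) K G, if b then insert K B else B,
                 \<lambda>L. if n + k \<in> L then Suc (D K) else D L)))) \<le>
        cnt m s + (case m of 0 \<Rightarrow> 0 | Suc m' \<Rightarrow> ennreal a * cnt m' s)"
      unfolding GBD using step[OF s[unfolded GBD]] by simp
  qed
  also have "\<dots> = (\<integral>\<^sup>+ s. cnt m s \<partial>depth_process b k n) +
      (case m of 0 \<Rightarrow> 0 | Suc m' \<Rightarrow> ennreal a * (\<integral>\<^sup>+ s. cnt m' s \<partial>depth_process b k n))"
    by (cases m) (simp_all add: nn_integral_add nn_integral_cmult)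
  also have "\<dots> \<le> ennreal (S ^ m / fact m) +
      (case m of 0 \<Rightarrow> 0 | Suc m' \<Rightarrow> ennreal a * ennreal (S ^ m' / fact m'))"
    using Suc.IH unfolding cnt_def S_def
    by (intro add_mono) (auto split: nat.split intro!: mult_left_mono)
  also have "\<dots> \<le> ennreal ((S + a) ^ m / fact m)"
  proof (cases m)
    case (Suc m')
    have "S ^ m / fact m + a * (S ^ m' / fact m') =
        (S ^ Suc m' + real (Suc m') * a * S ^ m') / fact (Suc m')"
    proof -
      have "real (Suc m') * a * S ^ m' / fact (Suc m') = a * (S ^ m' / fact m')"
        by (simp del: of_nat_Suc)
      then show ?thesis by (simp only: Suc add_divide_distrib)
    qed
    also have "\<dots> \<le> (S + a) ^ Suc m' / fact (Suc m')"
      using power_Suc_add_ge[OF a(2,1)] by (intro divide_right_mono) auto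
    finally show ?thesis
      using Suc a by (simp add: ennreal_mult[symmetric] ennreal_plus[symmetric] ennreal_leI del: ennreal_plus fact_Suc power_Suc)
  qed simp
  also have "S + a = weight_sum k ?r (Suc n)"
    by (simp add: S_def a_def weight_sum_def)
  finally show ?case by (simp only: cnt_def)
qed

text \<open>First moment method: on the bad event at least one clique has depth exactly
  \<open>Suc h\<close>, so the indicator of that event is at most the number of such
  cliques.\<close>

lemma depth_process_diameter:
  assumes k: "k > 1"
  shows "measure_pmf.prob (map_pmf fst (depth_process b k n))
           {G. graph_diameter G \<le> ereal (2 * real h + 1)}
         \<ge> 1 - weight_sum k (k - of_bool b) n ^ Suc h / fact (Suc h)"
proof -
  let ?p = "depth_process b k n" and ?E = "weight_sum k (k - of_bool b) n ^ Suc h / fact (Suc h)"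
  let ?bad = "{s :: nat pair_pre_digraph \<times> nat set set \<times> (nat set \<Rightarrow> nat).
      \<not> graph_diameter (fst s) \<le> ereal (2 * real h + 1)}"
  have "emeasure ?p ?bad = (\<integral>\<^sup>+ s. indicator ?bad s \<partial>?p)" by simp
  also have "\<dots> \<le> (\<integral>\<^sup>+ s. (case s of (G, B, D) \<Rightarrow> of_nat (card {L \<in> cliques k G. D L = Suc h})) \<partial>?p)"
  proof (intro nn_integral_mono_AE AE_pmfI)
    fix s assume s: "s \<in> set_pmf ?p"
    obtain G B D where GBD: "s = (G, B, D)" by (cases s)
    have st: "depth_state b k n G B D" using depth_process_support[OF k] s GBD by blast
    show "indicator ?bad s \<le>
        (case s of (G, B, D) \<Rightarrow> (of_nat (card {L \<in> cliques k G. D L = Suc h}) :: ennreal))"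
    proof (cases "s \<in> ?bad")
      case True
      then obtain K where K: "K \<in> cliques k G" "\<not> D K \<le> h"
        using depth_state_diameter[OF st, of h] GBD by auto
      \<comment> \<open>The depth of \<open>K\<close> may lie far above \<open>h\<close>; absence of
        gaps supplies a clique at level \<open>Suc h\<close> itself.\<close>
      then have "Suc h \<in> {..D K}" by simp
      then have "Suc h \<in> D ` cliques k G" using st K(1) unfolding depth_state_def by blast
      then have ne: "{L \<in> cliques k G. D L = Suc h} \<noteq> {}" by force
      have "finite {L \<in> cliques k G. D L = Suc h}"
        using card_available_cliques(1)[OF st] k by simp
      then have "card {L \<in> cliques k G. D L = Suc h} \<ge> 1"
        using ne by (metis One_nat_def Suc_leI card_gt_0_iff)
      then have "(1::ennreal) \<le> of_nat (card {L \<in> cliques k G. D L = Suc h})"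
        by (metis of_nat_1 of_nat_mono)
      then show ?thesis using GBD True by simp
    qed simp
  qed
  also have "\<dots> \<le> ennreal ?E" by (rule expected_cliques_at_depth[OF k])
  finally have "measure_pmf.prob ?p ?bad \<le> ?E"
    by (simp add: measure_pmf.emeasure_eq_measure weight_sum_nonneg del: fact_Suc power_Suc)
  moreover have "fst -` {G. graph_diameter G \<le> ereal (2 * real h + 1)} = UNIV - ?bad" by auto
  then have "measure_pmf.prob ?p (fst -` {G. graph_diameter G \<le> ereal (2 * real h + 1)}) =
      1 - measure_pmf.prob ?p ?bad"
    using measure_pmf.prob_compl[of ?bad ?p] by simp
  ultimately show ?thesis unfolding measure_map_pmf by linarith
qed

section \<open>Logarithmic and Stirling-type estimates\<close>

text \<open>The summand at \<open>t = 0\<close> contributes the separate \<open>real k\<close>;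
  dropping the 1 in the other denominators leaves \<open>k / r\<close> times a harmonic sum.\<close>

lemma weight_sum_le_ln:
  assumes r: "r \<ge> 1" and n: "n \<ge> 1"
  shows "weight_sum k r n \<le> real k + real k / real r * (1 + ln (real n))"
proof -
  have *: "real k / (1 + real r * real t) \<le> real k / real r * (1 / real t)" if "t \<ge> 1" for t
  proof -
    have "real k / (1 + real r * real t) \<le> real k / (real r * real t)"
      using r that by (intro divide_left_mono mult_pos_pos add_pos_nonneg) auto
    then show ?thesis by simp
  qed
  have "weight_sum k r (Suc n) \<le> real k + real k / real r * (1 + ln (real n))" if "n \<ge> 1" for n
    using that
  proof (induction n rule: nat_induct_at_least)
    case base
    then show ?case using *[of 1] by (simp add: weight_sum_def)
  next
    case (Suc n)
    have "ln (real n / real (Suc n)) \<le> real n / real (Suc n) - 1"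
      using Suc.hyps by (intro ln_le_minus_one) auto
    then have "1 / real (Suc n) \<le> ln (real (Suc n)) - ln (real n)"
      using Suc.hyps by (simp add: ln_div field_simps)
    then have "real k / real r * (1 / real (Suc n)) \<le>
        real k / real r * (ln (real (Suc n)) - ln (real n))"
      by (intro mult_left_mono) auto
    also have "\<dots> = real k / real r * (1 + ln (real (Suc n))) - real k / real r * (1 + ln (real n))"
      by (simp only: algebra_simps)
    finally have "real k / real r * (1 / real (Suc n)) \<le> \<dots>" .
    moreover have "weight_sum k r (Suc (Suc n)) =
        weight_sum k r (Suc n) + real k / (1 + real r * real (Suc n))"
      by (simp add: weight_sum_def)
    ultimately show ?case using Suc.IH *[of "Suc n"] by linarith
  qed
  moreover have "weight_sum k r n \<le> weight_sum k r (Suc n)" by (simp add: weight_sum_def)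
  ultimately show ?thesis using n by (meson order_trans)
qed

text \<open>The difference of the two sides vanishes at 0 and is nondecreasing as long as
  \<open>(1 + t / 4)^2 <= 1 + t\<close>, that is \<open>t * t <= 8 * t\<close>, whence the bound 8.
  It is applied at \<open>x = 1 / m\<close>.\<close>

lemma ln_add_one_le:
  fixes x :: real
  assumes "0 \<le> x" "x \<le> 8"
  shows "ln (1 + x) \<le> x / (1 + x / 4)"
proof -
  define f where "f x = x / (1 + x / 4) - ln (1 + x)" for x :: real
  have "f 0 \<le> f x"
  proof (rule DERIV_nonneg_imp_nondecreasing[OF assms(1)])
    fix t :: real assume t: "0 \<le> t" "t \<le> x"
    have "(f has_real_derivative (1 / (1 + t / 4)^2 - 1 / (1 + t))) (at t)"
      unfolding f_def using t
      by (auto intro!: derivative_eq_intros simp: field_simps power2_eq_square)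
    moreover have "(1 + t / 4)^2 \<le> 1 + t"
    proof -
      have "t * t \<le> 8 * t" using t assms by (intro mult_right_mono) auto
      then show ?thesis by (simp add: power2_eq_square algebra_simps)
    qed
    then have "1 / (1 + t / 4)^2 - 1 / (1 + t) \<ge> 0"
      using t by (simp add: frac_le)
    ultimately show "\<exists>y. (f has_real_derivative y) (at t) \<and> 0 \<le> y" by blast
  qed
  then show ?thesis by (simp add: f_def)
qed

text \<open>The factorial is at least \<open>(m / e) ^ m * m powr (1/4)\<close>. The plain bound
  \<open>(m / e) ^ m\<close> would only give 1; the extra power of \<open>m\<close> yields decay
  even when \<open>m\<close> is as small as \<open>exp 1 * x\<close> allows.\<close>

lemma power_div_fact_le:
  fixes x :: real
  assumes m: "m \<ge> 1" and x: "0 \<le> x" "exp 1 * x \<le> real m"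
  shows "x ^ m / fact m \<le> real m powr (-1/4)"
proof -
  have fct: "(real m + 1/4) * ln (real m) - real m \<le> ln (fact m)"
    using m
  proof (induction m rule: nat_induct_at_least)
    case base
    then show ?case by simp
  next
    case (Suc m)
    \<comment> \<open>The induction step amounts to
      \<open>(m + 1/4) * ln (1 + 1 / m) <= 1\<close>.\<close>
    have "ln (1 + 1 / real m) \<le> (1 / real m) / (1 + (1 / real m) / 4)"
      using Suc.hyps by (intro ln_add_one_le) (auto simp: field_simps)
    also have "\<dots> = 1 / (real m + 1/4)" using Suc.hyps by (simp add: field_simps)
    finally have "(real m + 1/4) * ln (1 + 1 / real m) \<le> 1" by (simp add: field_simps)
    moreover have "1 + 1 / real m = real (Suc m) / real m" using Suc.hyps by (simp add: field_simps)
    then have "ln (1 + 1 / real m) = ln (real (Suc m)) - ln (real m)"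
      using Suc.hyps by (simp add: ln_div)
    moreover have "ln (fact (Suc m)) = ln (real (Suc m)) + ln (fact m)"
      by (simp add: ln_mult del: of_nat_Suc)
    ultimately show ?case using Suc.IH by (simp add: algebra_simps)
  qed
  have mp: "real m > 0" using m by simp
  have "x \<le> real m / exp 1" using x by (simp add: field_simps)
  then have "x ^ m \<le> (real m / exp 1) ^ m" using x by (intro power_mono)
  also have "\<dots> = exp (real m * (ln (real m) - 1))"
    using mp by (simp add: exp_of_nat_mult exp_diff)
  also have "\<dots> \<le> exp (ln (fact m) - ln (real m) / 4)"
    using fct by (simp add: algebra_simps)
  also have "\<dots> = fact m * real m powr (-1/4)"
    unfolding diff_conv_add_uminus exp_add using mp by (simp add: powr_def)
  finally show ?thesis by (simp add: field_simps)
qed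

section \<open>Passage to the limit\<close>

text \<open>With \<open>T = k + c * (1 + ln n)\<close> bounding the weight sum, depth
  \<open>h <= exp 1 * T\<close> gives
  \<open>2 * h + 1 <= 2 * exp 1 * c * ln n + 2 * exp 1 * (k + c) + 1\<close>, which is the origin of
  the condition on \<open>C\<close>. For \<open>n >= 2\<close> the failure probability is at most
  \<open>ln n powr (-1/4)\<close>.\<close>

lemma depth_process_diameter_tendsto:
  fixes b :: bool and k :: nat
  assumes k: "k > 1" and c: "c = real k / real (k - of_bool b)"
    and C: "C \<ge> 2 * exp 1 * (real k + c) + 1"
  shows "(\<lambda>n. measure_pmf.prob (map_pmf fst (depth_process b k n))
            {G. graph_diameter G \<le> ereal (2 * exp 1 * c * ln (real n) + C)}) \<longlonglongrightarrow> 1"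
proof (rule tendsto_sandwich)
  have r: "k - of_bool b \<ge> 1" using k by (cases b) auto
  have "real (k - of_bool b) \<le> real k" "real (k - of_bool b) > 0"
    using r by (simp_all only: of_nat_le_iff diff_le_self of_nat_0_less_iff)
  then have c1: "c \<ge> 1" unfolding c by (simp only: le_divide_eq_1_pos)
  show "\<forall>\<^sub>F n in sequentially. measure_pmf.prob (map_pmf fst (depth_process b k n))
            {G. graph_diameter G \<le> ereal (2 * exp 1 * c * ln (real n) + C)} \<le> 1"
    by simp
  show "(\<lambda>n. 1 - ln (real n) powr (-1/4)) \<longlonglongrightarrow> 1"
    by real_asymp
  show "\<forall>\<^sub>F n in sequentially. 1 - ln (real n) powr (-1/4) \<le>
      measure_pmf.prob (map_pmf fst (depth_process b k n))
            {G. graph_diameter G \<le> ereal (2 * exp 1 * c * ln (real n) + C)}"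
    using eventually_ge_at_top[of 2]
  proof eventually_elim
    case (elim n)
    let ?S = "weight_sum k (k - of_bool b) n"
    define T where "T = real k + c * (1 + ln (real n))"
    have lnpos: "ln (real n) > 0" using elim by simp
    have ST: "?S \<le> T" unfolding T_def c using elim r by (intro weight_sum_le_ln) auto
    have "1 * ln (real n) \<le> c * ln (real n)" using c1 lnpos by (intro mult_right_mono) auto
    then have T: "ln (real n) \<le> T" unfolding T_def using c1 k by (simp add: algebra_simps)
    have eT: "1 * T \<le> exp 1 * T" using T lnpos by (intro mult_right_mono) auto
    \<comment> \<open>\<open>Suc h\<close> is the least integer not below \<open>exp 1 * T\<close>,
      as the factorial estimate requires, while \<open>h\<close> itself stays below
      \<open>exp 1 * T\<close>, so rounding adds nothing to the diameter bound.\<close>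
    define h where "h = nat \<lceil>exp 1 * T\<rceil> - 1"
    have pos: "exp 1 * T > 0" using T lnpos by simp
    then have Suc_h: "Suc h = nat \<lceil>exp 1 * T\<rceil>" unfolding h_def by simp
    have lower: "exp 1 * T \<le> real (Suc h)" unfolding Suc_h by linarith
    have ln_h: "ln (real n) \<le> real (Suc h)" using lower T eT by linarith
    have upper: "real h \<le> exp 1 * T" using Suc_h pos by linarith
    have "exp 1 * ?S \<le> exp 1 * T" using ST by (intro mult_left_mono) auto
    then have eS: "exp 1 * ?S \<le> real (Suc h)" using lower by linarith
    have "?S ^ Suc h / fact (Suc h) \<le> real (Suc h) powr (-1/4)"
      by (intro power_div_fact_le weight_sum_nonneg eS) simp
    also have "\<dots> \<le> ln (real n) powr (-1/4)"
      using ln_h lnpos by (intro powr_mono2') auto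
    finally have "1 - ln (real n) powr (-1/4) \<le>
        measure_pmf.prob (map_pmf fst (depth_process b k n))
            {G. graph_diameter G \<le> ereal (2 * real h + 1)}"
      using depth_process_diameter[OF k, where n = n and b = b and h = h] by linarith
    also have "\<dots> \<le> measure_pmf.prob (map_pmf fst (depth_process b k n))
            {G. graph_diameter G \<le> ereal (2 * exp 1 * c * ln (real n) + C)}"
    proof (intro measure_pmf.finite_measure_mono subsetI)
      fix G assume "G \<in> {G :: nat pair_pre_digraph. graph_diameter G \<le> ereal (2 * real h + 1)}"
      moreover have "2 * real h + 1 \<le> 2 * exp 1 * c * ln (real n) + C"
        using upper C unfolding T_def by (simp add: algebra_simps)
      ultimately show "G \<in> {G. graph_diameter G \<le> ereal (2 * exp 1 * c * ln (real n) + C)}"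
        by (auto intro: order_trans)
    qed simp
    finally show ?case .
  qed
qed simp

theorem theorem6p3:
  fixes k :: nat
  assumes "k > 1"
  shows "\<exists>C :: real.
    (\<lambda>n. measure_pmf.prob (random_increasing_k_tree k n)
            {G. graph_diameter G \<le> ereal (2 * exp 1 * ln (real n) + C)}) \<longlonglongrightarrow> 1 \<and>
    (\<lambda>n. measure_pmf.prob (random_apollonian_network k n)
            {G. graph_diameter G \<le> ereal (2 * exp 1 * real k * ln (real n) / (real k - 1) + C)})
       \<longlonglongrightarrow> 1"
proof -
  \<comment> \<open>The Apollonian value \<open>c = k / (k - 1)\<close> exceeds the tree value
    \<open>c = 1\<close>, so its constant serves both limits.\<close>
  define C where "C = 2 * exp 1 * (real k + real k / (real k - 1)) + 1"
  have "1 \<le> real k / (real k - 1)" using assms by (simp add: field_simps)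
  then have C: "C \<ge> 2 * exp 1 * (real k + 1) + 1" by (simp add: C_def)
  have tree: "(\<lambda>n. measure_pmf.prob (random_increasing_k_tree k n)
            {G. graph_diameter G \<le> ereal (2 * exp 1 * ln (real n) + C)}) \<longlonglongrightarrow> 1"
    using depth_process_diameter_tendsto[OF assms, of 1 False C] assms C
    by (simp add: map_fst_depth_process_False)
  have "(\<lambda>n. measure_pmf.prob (random_apollonian_network k n)
            {G. graph_diameter G \<le> ereal (2 * exp 1 * (real k / (real k - 1)) * ln (real n) + C)})
       \<longlonglongrightarrow> 1"
    using depth_process_diameter_tendsto[OF assms, of "real k / (real k - 1)" True C] assms C_def
    by (simp add: map_fst_depth_process_True of_nat_diff)
  then have "(\<lambda>n. measure_pmf.prob (random_apollonian_network k n)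
            {G. graph_diameter G \<le> ereal (2 * exp 1 * real k * ln (real n) / (real k - 1) + C)})
       \<longlonglongrightarrow> 1"
    by simp
  with tree show ?thesis by blast
qed

end
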